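(* For each integer $n$ with $2\leq n\leq 10^4$ there exist an integer $k\geq 2$ and positive integers $a_1<a_2<\cdots<a_k$ with $a_1=n+1$ and $a_i\geq n+i$ for $i=2,\ldots,k$ such that $$\frac{n}{2^{n}}=\sum_{i=1}^{k}\frac{a_{i}}{2^{a_{i}}}.$$ *)

theory Defs imports Complex_Main begin

end

theory Submission imports Defs begin

text \<open>Call \<open>r\<close> solvable at level \<open>m\<close> if \<open>r / 2 ^ m\<close> is a finite sum of distinct terms \<open>a / 2 ^ a\<close> with
  \<open>a > m\<close>. It suffices that \<open>2 * r\<close> or \<open>2 * r - (m + 1)\<close> is solvable at level \<open>m + 1\<close>, so if all
  \<open>r \<le> M\<close> are solvable at level \<open>M\<close>, the same holds at every lower level, and a single level
  \<open>M > 10 ^ 4\<close> decides the claim. At level 10005 each \<open>r\<close> is followed along the map \<open>r \<mapsto> 2 * r mod m\<close>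
  for increasing \<open>m\<close> until it reaches 0. This map is two-to-one for even \<open>m\<close>, so trajectories coalesce
  fast: 492 nonzero values are left at level 10070, 24 at level 11500, two at level 32000. The last one
  reaches 0 at level 460536. The computation is done by rewriting binary numbers.\<close>

section \<open>Solvability and descent through the levels\<close>

definition solvable :: "nat \<Rightarrow> nat \<Rightarrow> bool" where
  "solvable m r \<longleftrightarrow>
     (\<exists>S. finite S \<and> S \<subseteq> {m<..} \<and> real r / 2 ^ m = (\<Sum>a\<in>S. real a / 2 ^ a))"

lemma solvable_0: "solvable m 0"
  unfolding solvable_def by (rule exI[of _ "{}"]) simp

lemma solvable_double:
  assumes "solvable (Suc m) (2 * r)"
  shows "solvable m r"
proof -
  obtain S where "finite S" "S \<subseteq> {Suc m<..}"
    and "real (2 * r) / 2 ^ Suc m = (\<Sum>a\<in>S. real a / 2 ^ a)"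
    using assms unfolding solvable_def by blast
  then show ?thesis
    unfolding solvable_def by (intro exI[of _ S]) auto
qed

text \<open>Passing to level \<open>Suc m\<close> doubles the numerator, and the term of index
  \<open>Suc m\<close> then takes off exactly \<open>Suc m\<close>. The explicit set is needed again
  for the final representation.\<close>

lemma sum_insert_Suc_eq:
  assumes "finite S" "S \<subseteq> {Suc m<..}" "Suc m \<le> 2 * r"
    and "real (2 * r - Suc m) / 2 ^ Suc m = (\<Sum>a\<in>S. real a / 2 ^ a)"
  shows "real r / 2 ^ m = (\<Sum>a\<in>insert (Suc m) S. real a / 2 ^ a)"
proof -
  have "(\<Sum>a\<in>insert (Suc m) S. real a / 2 ^ a)
      = real (Suc m) / 2 ^ Suc m + real (2 * r - Suc m) / 2 ^ Suc m"
    using assms by (subst sum.insert) auto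
  also have "\<dots> = (real (Suc m) + real (2 * r - Suc m)) / 2 ^ Suc m"
    by (rule add_divide_distrib[symmetric])
  also have "real (Suc m) + real (2 * r - Suc m) = 2 * real r"
    using assms(3) by (simp add: of_nat_diff)
  finally show ?thesis by simp
qed

lemma solvable_double_diff:
  assumes "Suc m \<le> 2 * r" "solvable (Suc m) (2 * r - Suc m)"
  shows "solvable m r"
proof -
  obtain S where S: "finite S" "S \<subseteq> {Suc m<..}"
    and "real (2 * r - Suc m) / 2 ^ Suc m = (\<Sum>a\<in>S. real a / 2 ^ a)"
    using assms(2) unfolding solvable_def by blast
  from sum_insert_Suc_eq[OF S assms(1) this(3)] S show ?thesis
    unfolding solvable_def by (intro exI[of _ "insert (Suc m) S"]) auto
qed

text \<open>The bound is inherited going up: for \<open>r \<le> m\<close> either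
  \<open>2 * r < Suc m\<close>, or \<open>2 * r - Suc m < m\<close>.\<close>

lemma solvable_downward:
  assumes "\<And>r. r \<le> M \<Longrightarrow> solvable M r" "m \<le> M" "r \<le> m"
  shows "solvable m r"
  using assms(2,3)
proof (induction arbitrary: r rule: inc_induct)
  case base
  then show ?case by (rule assms(1))
next
  case (step m)
  show ?case
  proof (cases "Suc m \<le> 2 * r")
    case True
    show ?thesis by (rule solvable_double_diff) (use step True in auto)
  next
    case False
    show ?thesis by (rule solvable_double) (use step False in auto)
  qed
qed

section \<open>Forced trajectories\<close>

text \<open>The forced evolution of a remainder \<open>r\<close> at level \<open>m\<close>, written in the coordinates \<open>r\<close> and
  \<open>t = m + 1 - r\<close>, in which every step costs a single subtraction.\<close>

inductive halts :: "nat \<Rightarrow> nat \<Rightarrow> bool" where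
  "halts r r"
| "r < t \<Longrightarrow> halts (2 * r) (t - r + 1) \<Longrightarrow> halts r t"
| "t < r \<Longrightarrow> halts (r - t) (2 * t + 1) \<Longrightarrow> halts r t"

lemma halts_refl: "halts r r \<longleftrightarrow> True"
  by (simp add: halts.intros)

text \<open>The introduction rules of \<open>halts\<close> exclude each other, so each step can be
  read as an equation.\<close>

lemma halts_less: "r < t \<Longrightarrow> halts r t \<longleftrightarrow> halts (2 * r) (t - r + 1)"
  by (subst halts.simps) auto

lemma halts_greater: "t < r \<Longrightarrow> halts r t \<longleftrightarrow> halts (r - t) (2 * t + 1)"
  by (subst halts.simps) auto

text \<open>Each step raises \<open>r + t\<close> by one, hence the level by one. The comparison of
  \<open>r\<close> with \<open>t\<close> is that of \<open>2 * r\<close> with \<open>Suc m\<close>,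
  and equality leaves remainder 0.\<close>

lemma solvable_if_halts:
  assumes "halts r t" "r + t = Suc m"
  shows "solvable m r"
  using assms
proof (induction arbitrary: m)
  case (1 r)
  show ?case by (rule solvable_double_diff) (use 1 in \<open>auto simp: solvable_0\<close>)
next
  case (2 r t)
  show ?case by (rule solvable_double) (use 2 in auto)
next
  case (3 t r)
  have "2 * r - Suc m = r - t" using 3 by simp
  then show ?case by (intro solvable_double_diff[of m r]) (use 3 in \<open>auto simp: add.commute\<close>)
qed

section \<open>Binary arithmetic\<close>

text \<open>The outermost constructor is the least significant bit.\<close>

datatype bits = Z | B0 bits | B1 bits

primrec val :: "bits \<Rightarrow> nat" where
  "val Z = 0"
| "val (B0 x) = 2 * val x"
| "val (B1 x) = 2 * val x + 1"

primrec bits_of :: "num \<Rightarrow> bits" where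
  "bits_of num.One = B1 Z"
| "bits_of (num.Bit0 n) = B0 (bits_of n)"
| "bits_of (num.Bit1 n) = B1 (bits_of n)"

lemma val_bits_of: "val (bits_of n) = numeral n"
  by (induction n) (auto simp: numeral_Bit0 numeral_Bit1)

text \<open>Dropping leading zeros keeps the representations short.\<close>

fun dbl :: "bits \<Rightarrow> bits" where
  "dbl Z = Z"
| "dbl (B0 x) = B0 (B0 x)"
| "dbl (B1 x) = B0 (B1 x)"

fun inc :: "bits \<Rightarrow> bits" where
  "inc Z = B1 Z"
| "inc (B0 x) = B1 x"
| "inc (B1 x) = B0 (inc x)"

fun dec :: "bits \<Rightarrow> bits" where
  "dec Z = Z"
| "dec (B0 x) = B1 (dec x)"
| "dec (B1 x) = dbl x"

text \<open>\<open>sub_dec\<close> is subtraction with a pending borrow. Results where the true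
  difference is negative are arbitrary.\<close>

fun sub :: "bits \<Rightarrow> bits \<Rightarrow> bits" and sub_dec :: "bits \<Rightarrow> bits \<Rightarrow> bits" where
  "sub x Z = x"
| "sub Z (B0 y) = Z"
| "sub Z (B1 y) = Z"
| "sub (B0 x) (B0 y) = dbl (sub x y)"
| "sub (B0 x) (B1 y) = B1 (sub_dec x y)"
| "sub (B1 x) (B0 y) = B1 (sub x y)"
| "sub (B1 x) (B1 y) = dbl (sub x y)"
| "sub_dec x Z = dec x"
| "sub_dec Z (B0 y) = Z"
| "sub_dec Z (B1 y) = Z"
| "sub_dec (B0 x) (B0 y) = B1 (sub_dec x y)"
| "sub_dec (B0 x) (B1 y) = dbl (sub_dec x y)"
| "sub_dec (B1 x) (B0 y) = dbl (sub x y)"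
| "sub_dec (B1 x) (B1 y) = B1 (sub_dec x y)"

text \<open>Computes the new coordinate \<open>t - r + 1\<close> in one pass.\<close>

fun sub_inc :: "bits \<Rightarrow> bits \<Rightarrow> bits" where
  "sub_inc x Z = inc x"
| "sub_inc Z (B0 y) = B1 Z"
| "sub_inc Z (B1 y) = Z"
| "sub_inc (B0 x) (B0 y) = B1 (sub x y)"
| "sub_inc (B0 x) (B1 y) = dbl (sub x y)"
| "sub_inc (B1 x) (B0 y) = dbl (sub_inc x y)"
| "sub_inc (B1 x) (B1 y) = B1 (sub x y)"

lemma val_dbl: "val (dbl x) = 2 * val x"
  by (cases x) auto

lemma val_inc: "val (inc x) = val x + 1"
  by (induction x) auto

lemma val_dec: "0 < val x \<Longrightarrow> val (dec x) = val x - 1"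
  by (induction x) (auto simp: val_dbl)

lemma val_sub: "val y \<le> val x \<Longrightarrow> val (sub x y) = val x - val y"
  and val_sub_dec: "val y < val x \<Longrightarrow> val (sub_dec x y) = val x - val y - 1"
  by (induction x y and x y rule: sub_sub_dec.induct) (auto simp: val_dbl val_dec)

lemma val_sub_inc: "val y \<le> val x \<Longrightarrow> val (sub_inc x y) = val x - val y + 1"
  by (induction x y rule: sub_inc.induct) (auto simp: val_dbl val_inc val_sub)

datatype ordering = LT | EQ | GT

text \<open>The accumulator is the verdict of the lower bits read so far; a difference in a higher
  bit overrides it.\<close>

fun cmp :: "ordering \<Rightarrow> bits \<Rightarrow> bits \<Rightarrow> ordering" where
  "cmp c Z Z = c"
| "cmp c Z (B0 y) = cmp c Z y"
| "cmp c Z (B1 y) = LT"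
| "cmp c (B0 x) Z = cmp c x Z"
| "cmp c (B1 x) Z = GT"
| "cmp c (B0 x) (B0 y) = cmp c x y"
| "cmp c (B0 x) (B1 y) = cmp LT x y"
| "cmp c (B1 x) (B0 y) = cmp GT x y"
| "cmp c (B1 x) (B1 y) = cmp c x y"

lemma cmp_eq: "cmp c x y = (if val x < val y then LT else if val y < val x then GT else c)"
  by (induction c x y rule: cmp.induct) (auto, presburger+)

definition halts_bits :: "bits \<Rightarrow> bits \<Rightarrow> bool" where
  "halts_bits x y \<longleftrightarrow> halts (val x) (val y)"

text \<open>Matching on a constructor delays the next state until the comparison has been
  evaluated.\<close>

fun halts_case :: "ordering \<Rightarrow> bits \<Rightarrow> bits \<Rightarrow> bool" where
  "halts_case LT x y \<longleftrightarrow> halts_bits (B0 x) (sub_inc y x)"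
| "halts_case EQ x y \<longleftrightarrow> True"
| "halts_case GT x y \<longleftrightarrow> halts_bits (sub x y) (B1 y)"

text \<open>The vacuous premise makes the simplifier try unconditional rewrite rules first, so that a
  trajectory is followed only until it meets a state already known to halt.\<close>

lemma halts_bits_step:
  assumes True
  shows "halts_bits x y \<longleftrightarrow> halts_case (cmp EQ x y) x y"
proof (cases "val x" "val y" rule: linorder_cases)
  case less
  then show ?thesis
    by (simp add: halts_bits_def cmp_eq halts_less val_sub_inc)
next
  case equal
  then show ?thesis
    by (simp add: halts_bits_def cmp_eq halts_refl)
next
  case greater
  then show ?thesis
    by (simp add: halts_bits_def cmp_eq halts_greater val_sub)
qed

section \<open>Evaluation of the trajectories, from high levels down\<close>

lemmas eval_simps =
  halts_bits_step halts_case.simps cmp.simps sub.simps sub_dec.simps sub_inc.simps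
  dbl.simps inc.simps dec.simps simp_thms

text \<open>Through this rule \<open>[simplified]\<close> turns a proved checkpoint into ground
  facts on \<open>halts_bits\<close>, which rewrite a matching state to True. The match is
  syntactic, so states must have no leading zeros.\<close>

lemma halts_numeral [simp]: "halts (numeral a) (numeral b) \<longleftrightarrow> halts_bits (bits_of a) (bits_of b)"
  by (simp add: halts_bits_def val_bits_of)

text \<open>The values listed at a level are the nonzero ones reached there from level 10005.\<close>

lemma halts_400000: "halts 150456 249545"
  by (simp, simp only: eval_simps)

lemma halts_350000: "halts 202186 147815"
  by (simp, simp only: eval_simps halts_400000[simplified])

lemma halts_300000: "halts 228032 71969"
  by (simp, simp only: eval_simps halts_350000[simplified])

lemma halts_250000: "halts 68138 181863"
  by (simp, simp only: eval_simps halts_300000[simplified])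

lemma halts_200000: "halts 141186 58815"
  by (simp, simp only: eval_simps halts_250000[simplified])

lemma halts_150000:
  "list_all (\<lambda>r. halts r (150001 - r))
   [8520, 141482]"
  by (simp, simp only: eval_simps halts_200000[simplified])

lemma halts_100000:
  "list_all (\<lambda>r. halts r (100001 - r))
   [22242, 77760]"
  by (simp, simp only: eval_simps halts_150000[simplified])

lemma halts_60000:
  "list_all (\<lambda>r. halts r (60001 - r))
   [27912, 32090]"
  by (simp, simp only: eval_simps halts_100000[simplified])

lemma halts_32000:
  "list_all (\<lambda>r. halts r (32001 - r))
   [11906, 30274]"
  by (simp, simp only: eval_simps halts_60000[simplified])

lemma halts_23000:
  "list_all (\<lambda>r. halts r (23001 - r))
   [6432, 16570, 20384]"
  by (simp, simp only: eval_simps halts_32000[simplified])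

lemma halts_19000:
  "list_all (\<lambda>r. halts r (19001 - r))
   [15080, 17216, 17818, 18752]"
  by (simp, simp only: eval_simps halts_23000[simplified])

lemma halts_15000:
  "list_all (\<lambda>r. halts r (15001 - r))
   [3066, 4634, 5018, 5696, 6562, 9306, 11936]"
  by (simp, simp only: eval_simps halts_19000[simplified])

lemma halts_12500:
  "list_all (\<lambda>r. halts r (12501 - r))
   [62, 612, 1162, 4358, 4528, 4688, 8060, 8144, 11340, 11890, 12440]"
  by (simp, simp only: eval_simps halts_15000[simplified])

lemma halts_11500:
  "list_all (\<lambda>r. halts r (11501 - r))
   [226, 534, 970, 2080, 2208, 2488, 2808, 3766, 3914, 4756, 4866, 5376, 5688, 6126, 6636, 6746,
    7588, 7736, 8694, 9014, 9422, 10532, 10968, 11276]"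
  by (simp, simp only: eval_simps halts_12500[simplified])

lemma halts_10650:
  "list_all (\<lambda>r. halts r (10651 - r))
   [22, 232, 476, 764, 814, 896, 1102, 1286, 1742, 1812, 1998, 2428, 2568, 2606, 2662, 3232,
    3744, 3758, 3816, 4046, 4206, 4552, 4782, 4870, 5046, 5606, 5782, 6100, 6446, 6606, 6836,
    6894, 6908, 7420, 7990, 8046, 8084, 8224, 8654, 8840, 8910, 9038, 9366, 9550, 9756, 9888,
    10176, 10630]"
  by (simp, simp only: eval_simps halts_11500[simplified])

lemma halts_10250:
  "list_all (\<lambda>r. halts r (10251 - r))
   [12, 108, 128, 356, 480, 516, 524, 552, 608, 772, 776, 896, 964, 968, 1024, 1088, 1092, 1164,
    1220, 1280, 1316, 1380, 1448, 1472, 1508, 1544, 1568, 1604, 1608, 1676, 1732, 1792, 2116,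
    2382, 2404, 2500, 2638, 2668, 2830, 2884, 2894, 2916, 2926, 3012, 3022, 3044, 3084, 3116,
    3118, 3182, 3244, 3268, 3364, 3428, 3566, 3606, 3662, 3790, 3820, 4414, 4438, 4606, 4670,
    4846, 4878, 4886, 4974, 5054, 5086, 5102, 5118, 5134, 5150, 5166, 5198, 5278, 5366, 5374,
    5406, 5582, 5646, 5814, 5838, 6432, 6462, 6590, 6646, 6686, 6824, 6888, 6984, 7008, 7070,
    7134, 7136, 7168, 7208, 7230, 7240, 7326, 7336, 7358, 7368, 7422, 7464, 7584, 7614, 7752,
    7848, 8136, 8460, 8520, 8576, 8644, 8648, 8684, 8708, 8744, 8780, 8804, 8872, 8936, 8972,
    9032, 9088, 9160, 9164, 9228, 9284, 9288, 9356, 9476, 9480, 9644, 9700, 9728, 9736, 9772,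
    9896, 10124, 10144]"
  by (simp, simp only: eval_simps halts_10650[simplified])

lemma halts_10070:
  "list_all (\<lambda>r. halts r (10071 - r))
   [18, 24, 40, 58, 96, 114, 150, 158, 176, 186, 248, 286, 314, 322, 328, 344, 346, 358, 360,
    376, 414, 418, 456, 480, 496, 504, 512, 528, 552, 566, 608, 632, 688, 702, 736, 760, 784,
    798, 816, 822, 830, 834, 840, 850, 856, 872, 888, 898, 912, 950, 968, 1006, 1008, 1034,
    1126, 1144, 1170, 1192, 1206, 1214, 1218, 1240, 1254, 1272, 1334, 1362, 1366, 1382, 1390,
    1418, 1498, 1514, 1520, 1554, 1650, 1656, 1670, 1680, 1710, 1728, 1736, 1760, 1784, 1834,
    1856, 1862, 1888, 1896, 1904, 1936, 2010, 2016, 2024, 2066, 2074, 2082, 2094, 2102, 2120,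
    2144, 2198, 2200, 2216, 2230, 2240, 2246, 2278, 2320, 2346, 2352, 2366, 2376, 2392, 2414,
    2448, 2490, 2518, 2528, 2558, 2560, 2562, 2576, 2584, 2586, 2600, 2606, 2662, 2710, 2714,
    2742, 2760, 2832, 2898, 2904, 2920, 2922, 2936, 2946, 2978, 3016, 3022, 3040, 3048, 3050,
    3056, 3098, 3118, 3126, 3230, 3240, 3246, 3266, 3272, 3288, 3296, 3338, 3370, 3386, 3390,
    3392, 3416, 3424, 3430, 3432, 3440, 3442, 3454, 3472, 3534, 3542, 3552, 3570, 3576, 3594,
    3608, 3624, 3686, 3718, 3722, 3734, 3736, 3746, 3752, 3760, 3800, 3826, 3832, 3898, 3928,
    3936, 3946, 3950, 3952, 3954, 3960, 3966, 3978, 4026, 4070, 4072, 4082, 4096, 4102, 4112,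
    4118, 4120, 4198, 4230, 4242, 4254, 4264, 4270, 4288, 4296, 4302, 4320, 4326, 4400, 4416,
    4448, 4456, 4496, 4534, 4538, 4552, 4584, 4590, 4592, 4624, 4630, 4680, 4728, 4746, 4770,
    4776, 4806, 4832, 4874, 4880, 4912, 4922, 4930, 4968, 4990, 4994, 5002, 5070, 5078, 5082,
    5104, 5142, 5150, 5160, 5192, 5198, 5240, 5266, 5296, 5302, 5326, 5344, 5392, 5442, 5448,
    5480, 5482, 5488, 5520, 5534, 5538, 5576, 5616, 5624, 5656, 5672, 5746, 5752, 5770, 5776,
    5784, 5802, 5808, 5818, 5830, 5842, 5862, 5874, 5952, 5954, 5960, 5970, 5976, 5990, 6000,
    6002, 6046, 6094, 6106, 6112, 6118, 6120, 6122, 6126, 6136, 6144, 6174, 6240, 6246, 6272,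
    6312, 6320, 6326, 6336, 6338, 6350, 6354, 6386, 6448, 6464, 6478, 6496, 6502, 6520, 6530,
    6538, 6600, 6618, 6630, 6632, 6640, 6642, 6648, 6656, 6680, 6682, 6686, 6702, 6734, 6776,
    6784, 6800, 6806, 6826, 6832, 6842, 6946, 6954, 6974, 7016, 7022, 7024, 7032, 7050, 7056,
    7094, 7126, 7136, 7150, 7152, 7168, 7174, 7240, 7312, 7330, 7358, 7362, 7410, 7466, 7472,
    7486, 7488, 7496, 7510, 7512, 7514, 7544, 7554, 7582, 7624, 7658, 7680, 7696, 7706, 7720,
    7726, 7752, 7794, 7826, 7832, 7842, 7856, 7872, 7874, 7928, 7952, 7970, 7978, 7990, 7998,
    8006, 8048, 8056, 8062, 8136, 8168, 8176, 8184, 8210, 8216, 8238, 8288, 8312, 8336, 8344,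
    8362, 8392, 8402, 8416, 8422, 8518, 8552, 8558, 8574, 8654, 8682, 8690, 8706, 8710, 8738,
    8800, 8818, 8832, 8854, 8858, 8866, 8880, 8902, 8928, 8946, 9038, 9064, 9066, 9104, 9122,
    9160, 9174, 9184, 9200, 9216, 9222, 9232, 9238, 9242, 9250, 9256, 9274, 9288, 9312, 9336,
    9370, 9384, 9440, 9464, 9506, 9520, 9544, 9568, 9576, 9592, 9616, 9654, 9658, 9696, 9712,
    9714, 9726, 9728, 9744, 9750, 9758, 9786, 9824, 9886, 9896, 9914, 9922, 9958, 9976, 10014,
    10032, 10048, 10054]"
  by (simp, simp only: eval_simps halts_10250[simplified])

section \<open>From level 10008 down to level 10005\<close>

lemma halts_10008_0: "list_all (\<lambda>i. halts (8 * i) (10009 - 8 * i)) [1..<1251]"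
  \<comment> \<open>The interval is unrolled automatically only from numeral bounds; the start 1 is
    unrolled by hand and must not become \<open>Suc 0\<close>.\<close>
  by (simp add: upt_rec[of 1] del: One_nat_def, simp only: eval_simps halts_10070[simplified])

lemma halts_10008_2: "list_all (\<lambda>i. halts (8 * i + 2) (10007 - 8 * i)) [0..<1251]"
  by (simp add: upt_rec[of 0] upt_rec[of 1] flip: One_nat_def,
      simp only: eval_simps halts_10070[simplified])

lemma solvable_10008:
  assumes "i \<le> 1250"
  shows "solvable 10008 (8 * i)" and "solvable 10008 (8 * i + 2)"
proof -
  show "solvable 10008 (8 * i)"
  \<comment> \<open>Remainder 0 is solved by the empty sum, but its forced evolution stays at 0 and
    never halts.\<close>
  proof (cases "i = 0")
    case False
    then have "halts (8 * i) (10009 - 8 * i)"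
      by (intro bspec[OF halts_10008_0[unfolded list_all_iff set_upt]]) (use assms in auto)
    then show ?thesis using assms by (intro solvable_if_halts) auto
  qed (simp add: solvable_0)
  have "halts (8 * i + 2) (10007 - 8 * i)"
    by (intro bspec[OF halts_10008_2[unfolded list_all_iff set_upt]]) (use assms in auto)
  then show "solvable 10008 (8 * i + 2)" using assms by (intro solvable_if_halts) auto
qed

text \<open>The parities of the moduli 10006, 10007, 10008 make the trajectories of all residues meet in
  two residue classes modulo 8.\<close>

lemma solvable_10005:
  assumes "r \<le> 10005"
  shows "solvable 10005 r"
proof -
  \<comment> \<open>Since 10008 = 8 * 1251, doubling modulo 10008 sends multiples of 4 to multiples
    of 8.\<close>
  have even: "solvable 10007 (4 * i)" if "i \<le> 2501" for i
  proof (cases "i \<le> 1250")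
    case True
    show ?thesis by (rule solvable_double) (use solvable_10008(1)[of i] True in simp)
  next
    case False
    then have eq: "2 * (4 * i) - Suc 10007 = 8 * (i - 1251)" by simp
    show ?thesis
      by (rule solvable_double_diff) (use eq False that solvable_10008(1)[of "i - 1251"] in auto)
  qed
  \<comment> \<open>Both 2 * 10007 = 8 * 2502 - 2 and 2 * 10007 + 10008 = 8 * 3753 - 2, so either
    branch ends at 2 modulo 8.\<close>
  have odd: "solvable 10007 (4 * i - 10007)" if "2502 \<le> i" "i \<le> 5002" for i
  proof (cases "i \<le> 3752")
    case True
    then have eq: "2 * (4 * i - 10007) = 8 * (i - 2502) + 2" using that by simp
    show ?thesis
      by (rule solvable_double) (use eq True solvable_10008(2)[of "i - 2502"] in simp)
  next
    case False
    then have eq: "2 * (4 * i - 10007) - Suc 10007 = 8 * (i - 3753) + 2" by simp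
    show ?thesis
      by (rule solvable_double_diff) (use eq False that solvable_10008(2)[of "i - 3753"] in auto)
  qed
  \<comment> \<open>The modulus 10007 is odd, so wrapping around produces the odd values
    \<open>4 * i - 10007\<close>.\<close>
  have double: "solvable 10006 (2 * i)" if "i \<le> 5002" for i
  proof (cases "i \<le> 2501")
    case True
    show ?thesis by (rule solvable_double) (use even[of i] True in simp)
  next
    case False
    then have eq: "2 * (2 * i) - Suc 10006 = 4 * i - 10007" by simp
    show ?thesis
      by (rule solvable_double_diff) (use eq False that odd[of i] in auto)
  qed
  show ?thesis
  proof (cases "r \<le> 5002")
    case True
    show ?thesis by (rule solvable_double) (use double[of r] True in simp)
  next
    case False
    then have eq: "2 * r - Suc 10005 = 2 * (r - 5003)" by simp
    show ?thesis
      by (rule solvable_double_diff) (use eq False assms double[of "r - 5003"] in auto)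
  qed
qed

section \<open>Increasing enumeration and conclusion\<close>

lemma finite_set_enumeration:
  fixes A :: "nat set"
  assumes "finite A"
  obtains a where "strict_mono_on {1..card A} a" "bij_betw a {1..card A} A"
proof
  let ?xs = "sorted_list_of_set A" and ?a = "\<lambda>i. sorted_list_of_set A ! (i - 1)"
  show mono: "strict_mono_on {1..card A} ?a"
    by (rule strict_mono_onI) (auto intro!: sorted_wrt_nth_less[of "(<)"])
  have "?a ` {1..card A} = set ?xs"
  proof -
    have "(\<lambda>i. i - 1) ` {1..card A} = {..<length ?xs}"
      by (force simp: image_iff intro!: bexI[of _ "Suc _"])
    then have "?a ` {1..card A} = (!) ?xs ` {..<length ?xs}"
      by (metis (no_types, lifting) image_cong image_image)
    also have "\<dots> = set ?xs"
      by (auto simp: set_conv_nth)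
    finally show ?thesis .
  qed
  then show "bij_betw ?a {1..card A} A"
    using mono assms by (simp add: bij_betw_def strict_mono_on_imp_inj_on)
qed

theorem theorem3p5:
  fixes n :: nat
  assumes "2 \<le> n" and "n \<le> 10 ^ 4"
  shows "\<exists>(k::nat) (a :: nat \<Rightarrow> nat).
           k \<ge> 2 \<and>
           (\<forall>i\<in>{1..k}. 0 < a i) \<and>
           strict_mono_on {1..k} a \<and>
           a 1 = n + 1 \<and>
           (\<forall>i\<in>{2..k}. a i \<ge> n + i) \<and>
           real n / 2 ^ n = (\<Sum>i=1..k. real (a i) / 2 ^ (a i))"
proof -
  \<comment> \<open>The term of index \<open>n + 1\<close> is forced to be used; the remainder at
    the next level is \<open>n - 1\<close>.\<close>
  have "solvable (Suc n) (2 * n - Suc n)"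
    using assms by (intro solvable_downward[OF solvable_10005]) auto
  then obtain S where S: "finite S" "S \<subseteq> {Suc n<..}"
    and sum: "real (2 * n - Suc n) / 2 ^ Suc n = (\<Sum>a\<in>S. real a / 2 ^ a)"
    unfolding solvable_def by blast
  define A where "A = insert (Suc n) S"
  have A: "finite A" "A \<subseteq> {n<..}" "Suc n \<in> A"
    using S by (auto simp: A_def)
  \<comment> \<open>The remainder \<open>n - 1\<close> is positive because \<open>n \<ge> 2\<close>,
    so a second term exists.\<close>
  have "S \<noteq> {}"
    using sum assms(1) by auto
  then have card: "card A \<ge> 2"
    using S by (auto simp: A_def card_insert_if Suc_le_eq card_gt_0_iff)
  obtain a where mono: "strict_mono_on {1..card A} a" and bij: "bij_betw a {1..card A} A"
    using finite_set_enumeration[OF A(1)] .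
  have mem: "a i \<in> A" if "i \<in> {1..card A}" for i
    using bij_betwE[OF bij] that by blast
  have first: "a 1 = n + 1"
  proof -
    obtain i where i: "i \<in> {1..card A}" "a i = Suc n"
      using bij A(3) by (metis bij_betw_def imageE)
    have "a 1 \<le> a i"
      using strict_mono_on_leD[OF mono, of 1 i] i card by auto
    moreover have "n < a 1"
      using mem[of 1] A(2) card by auto
    ultimately show ?thesis using i by simp
  qed
  \<comment> \<open>A strictly increasing integer sequence starting at \<open>n + 1\<close> gains at
    least one per step.\<close>
  have lower: "n + i \<le> a i" if "1 \<le> i" "i \<le> card A" for i
    using that
  proof (induction i rule: dec_induct)
    case base
    then show ?case using first by simp
  next
    case (step i)
    have "a i < a (Suc i)"
      using step by (intro strict_mono_onD[OF mono]) auto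
    then show ?case using step by simp
  qed
  have "real n / 2 ^ n = (\<Sum>b\<in>A. real b / 2 ^ b)"
    unfolding A_def using S sum assms(1) by (intro sum_insert_Suc_eq) auto
  also have "\<dots> = (\<Sum>i=1..card A. real (a i) / 2 ^ a i)"
    by (rule sum.reindex_bij_betw[OF bij, symmetric])
  finally show ?thesis
    using card mono first lower by (intro exI[of _ "card A"] exI[of _ a]) fastforce
qed

end
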